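(* Let $\mathbb{F}$ be a field of characteristic $0$, let $n\ge 1$ be an integer, and let $\mathcal{J}_p\in\{\{0\},\mathbb{N}\}$ for $p\in\{1,\dots,n\}$, where $\mathbb{N}=\{0,1,2,\dots\}$. Let $\Gamma$ be a torsion-free abelian group and let $\varphi_1,\dots,\varphi_n:\Gamma\to\mathbb{F}$ be additive group homomorphisms such that $$\Big(\bigcap_{q\in\{1,\dots,n\},\,q\ne p}\ker\varphi_q\Big)\setminus\ker\varphi_p\neq\emptyset\quad\text{for every } p\in\{1,\dots,n\}\text{ with }\mathcal{J}_p=\{0\},\qquad \bigcap_{p=1}^n\ker\varphi_p=\{0\}$$ (an empty intersection being $\Gamma$). Let $\mathcal{A}$ be the commutative associative algebra and $\partial_1,\dots,\partial_n$ the derivations of $\mathcal{A}$ constructed from these data in the context. Then the Lie algebra $\mathcal{W}=\sum_{p=1}^n\mathcal{A}\partial_p$ is simple.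
   Context: Put $\vec{\mathcal{J}}=\mathcal{J}_1\times\cdots\times\mathcal{J}_n$ with componentwise addition. $\mathcal{A}$ is the $\mathbb{F}$-vector space with basis $\{x^{\alpha,\vec i}\mid(\alpha,\vec i)\in\Gamma\times\vec{\mathcal{J}}\}$ and multiplication $x^{\alpha,\vec i}\cdot x^{\beta,\vec j}=x^{\alpha+\beta,\vec i+\vec j}$; its identity is $1=x^{0,\vec 0}$. For $p\in\{1,\dots,n\}$ let $1_{[p]}$ be the vector with $1$ in position $p$ and $0$ elsewhere, and define linear maps on $\mathcal{A}$ by $$\partial_{\varphi_p}(x^{\alpha,\vec i})=\varphi_p(\alpha)x^{\alpha,\vec i},\qquad \hat\partial_p(x^{\alpha,\vec i})=i_p\,x^{\alpha,\vec i-1_{[p]}},\qquad \partial_p=\partial_{\varphi_p}+\hat\partial_p,$$ with the convention that an undefined basis symbol (one whose index $\vec i-1_{[p]}$ is not in $\vec{\mathcal{J}}$) is $0$. These maps are mutually commuting derivations of $\mathcal{A}$. Elements of $\mathcal{A}$ are identified with their multiplication operators, and $\mathcal{W}=\sum_{p=1}^n\mathcal{A}\partial_p$ is the resulting Lie subalgebra of the derivation algebra of $\mathcal{A}$, with bracket $$\Big[\sum_{p}u_p\partial_p,\sum_{q}v_q\partial_q\Big]=\sum_{p,q=1}^n\big(u_p\partial_p(v_q)-\partial_p(u_q)v_p\big)\partial_q\qquad(u_p,v_q\in\mathcal{A}).$$ *)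

theory Defs
  imports
    "HOL-Analysis.Finite_Cartesian_Product"
    "HOL-Library.Function_Algebras"
    "HOL-Library.Product_Plus"
    "HOL-Library.Poly_Mapping"
begin

section \<open>Simple Lie algebras\<close>

text \<open>
  The underlying vector space is a subspace \<open>L\<close> of a type; bracket and axioms are
  relativised to \<open>L\<close>.
\<close>

locale lie_algebra = vector_space scale
  for scale :: "'f::field \<Rightarrow> 'v::ab_group_add \<Rightarrow> 'v" +
  fixes L :: "'v set" and bracket :: "'v \<Rightarrow> 'v \<Rightarrow> 'v"
  assumes subspace_L: "subspace L"
    and bracket_closed: "\<lbrakk>x \<in> L; y \<in> L\<rbrakk> \<Longrightarrow> bracket x y \<in> L"
    and bracket_add_left:
      "\<lbrakk>x \<in> L; y \<in> L; z \<in> L\<rbrakk> \<Longrightarrow> bracket (x + y) z = bracket x z + bracket y z"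
    and bracket_add_right:
      "\<lbrakk>x \<in> L; y \<in> L; z \<in> L\<rbrakk> \<Longrightarrow> bracket x (y + z) = bracket x y + bracket x z"
    and bracket_scale_left:
      "\<lbrakk>x \<in> L; y \<in> L\<rbrakk> \<Longrightarrow> bracket (scale c x) y = scale c (bracket x y)"
    and bracket_scale_right:
      "\<lbrakk>x \<in> L; y \<in> L\<rbrakk> \<Longrightarrow> bracket x (scale c y) = scale c (bracket x y)"
    and bracket_self: "x \<in> L \<Longrightarrow> bracket x x = 0"
    and jacobi: "\<lbrakk>x \<in> L; y \<in> L; z \<in> L\<rbrakk> \<Longrightarrow>
      bracket x (bracket y z) + bracket y (bracket z x) + bracket z (bracket x y) = 0"
begin

definition lie_ideal :: "'v set \<Rightarrow> bool" where
  "lie_ideal I \<longleftrightarrow> I \<subseteq> L \<and> subspace I \<and> (\<forall>x\<in>L. \<forall>y\<in>I. bracket x y \<in> I)"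

end

locale simple_lie_algebra = lie_algebra +
  assumes not_abelian: "\<exists>x\<in>L. \<exists>y\<in>L. bracket x y \<noteq> 0"
    and ideal_trivial: "lie_ideal I \<Longrightarrow> I = {0} \<or> I = L"

section \<open>The algebra and its derivations\<close>

definition torsion_free :: "'g::ab_group_add itself \<Rightarrow> bool" where
  "torsion_free _ \<longleftrightarrow> (\<forall>(k::nat) (a::'g). k > 0 \<and> ((+) a ^^ k) 0 = 0 \<longrightarrow> a = 0)"

definition ker :: "('g \<Rightarrow> 'f::zero) \<Rightarrow> 'g set" where
  "ker f = {a. f a = 0}"

text \<open>
  The index set \<open>{1..n}\<close> is a finite type \<open>'n\<close>. The type \<open>'g \<times> (nat ^ 'n) \<Rightarrow>\<^sub>0 'f\<close> of
  finitely supported functions, with the convolution product, has the basis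
  \<open>x\<^bsup>\<alpha>,i\<^esup> = single (\<alpha>, i) 1\<close> for all \<open>i\<close> in \<open>nat ^ 'n\<close>. The algebra of a family
  \<open>J\<close> is the subalgebra spanned by those \<open>x\<^bsup>\<alpha>,i\<^esup>\<close> with \<open>i\<close> in the product of the \<open>J p\<close>.
\<close>

type_synonym ('g, 'n, 'f) alg = "('g \<times> (nat ^ 'n)) \<Rightarrow>\<^sub>0 'f"

abbreviation xpow :: "'g \<Rightarrow> nat ^ 'n \<Rightarrow> ('g, 'n::finite, 'f::zero_neq_one) alg" where
  "xpow \<alpha> i \<equiv> Poly_Mapping.single (\<alpha>, i) 1"

definition scl :: "'f::field \<Rightarrow> ('k \<Rightarrow>\<^sub>0 'f) \<Rightarrow> ('k \<Rightarrow>\<^sub>0 'f)" where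
  "scl c a = Poly_Mapping.map ((*) c) a"

definition algA :: "('n \<Rightarrow> nat set) \<Rightarrow> ('g, 'n::finite, 'f::zero) alg set" where
  "algA J = {a. \<forall>(\<alpha>, i) \<in> Poly_Mapping.keys a. \<forall>p. i $ p \<in> J p}"

text \<open>The linear map with prescribed values on the basis of indicator functions.\<close>

definition lin_ext :: "('k \<Rightarrow> ('l \<Rightarrow>\<^sub>0 'f)) \<Rightarrow> ('k \<Rightarrow>\<^sub>0 'f::field) \<Rightarrow> ('l \<Rightarrow>\<^sub>0 'f)" where
  "lin_ext f a = (\<Sum>k\<in>Poly_Mapping.keys a. scl (Poly_Mapping.lookup a k) (f k))"

definition d_phi :: "('n \<Rightarrow> 'g \<Rightarrow> 'f) \<Rightarrow> 'n \<Rightarrow> ('g, 'n::finite, 'f::field) alg \<Rightarrow> ('g, 'n, 'f) alg"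
  where "d_phi \<phi> p = lin_ext (\<lambda>(\<alpha>, i). scl (\<phi> p \<alpha>) (xpow \<alpha> i))"

text \<open>
  If \<open>i $ p = 0\<close>, then \<open>i - axis p 1\<close> is truncated to \<open>i\<close>, but the coefficient
  vanishes. If \<open>i $ p > 0\<close> for some \<open>i\<close> in the product of the \<open>J q\<close>, then \<open>J p\<close> is all of \<open>nat\<close>
  and \<open>i - axis p 1\<close> lies in the product again. So the value below agrees with the convention
  that undefined basis symbols are \<open>0\<close>.
\<close>

definition d_hat :: "'n \<Rightarrow> ('g, 'n::finite, 'f::field) alg \<Rightarrow> ('g, 'n, 'f) alg" where
  "d_hat p = lin_ext (\<lambda>(\<alpha>, i). scl (of_nat (i $ p)) (xpow \<alpha> (i - axis p 1)))"

definition partial :: "('n \<Rightarrow> 'g \<Rightarrow> 'f) \<Rightarrow> 'n \<Rightarrow> ('g, 'n::finite, 'f::field) alg \<Rightarrow> ('g, 'n, 'f) alg"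
  where "partial \<phi> p a = d_phi \<phi> p a + d_hat p a"

section \<open>The Lie algebra \<open>\<W>\<close>\<close>

text \<open>
  An endomorphism of \<open>algA J\<close> is represented by its extension by \<open>0\<close> outside \<open>algA J\<close>, so
  that equality in the function type is equality of maps on \<open>algA J\<close>.
\<close>

definition W_op :: "('n \<Rightarrow> nat set) \<Rightarrow> ('n \<Rightarrow> 'g \<Rightarrow> 'f) \<Rightarrow> ('n \<Rightarrow> ('g, 'n, 'f) alg)
    \<Rightarrow> ('g::ab_group_add, 'n::finite, 'f::field) alg \<Rightarrow> ('g, 'n, 'f) alg" where
  "W_op J \<phi> u = (\<lambda>a. if a \<in> algA J then \<Sum>p\<in>UNIV. u p * partial \<phi> p a else 0)"

definition W :: "('n \<Rightarrow> nat set) \<Rightarrow> ('n \<Rightarrow> 'g \<Rightarrow> 'f)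
    \<Rightarrow> (('g::ab_group_add, 'n::finite, 'f::field) alg \<Rightarrow> ('g, 'n, 'f) alg) set" where
  "W J \<phi> = {W_op J \<phi> u | u. \<forall>p. u p \<in> algA J}"

definition op_scl :: "'f::field \<Rightarrow> ('a \<Rightarrow> ('k \<Rightarrow>\<^sub>0 'f)) \<Rightarrow> ('a \<Rightarrow> ('k \<Rightarrow>\<^sub>0 'f))" where
  "op_scl c D = (\<lambda>a. scl c (D a))"

definition commutator :: "('a \<Rightarrow> 'a) \<Rightarrow> ('a \<Rightarrow> 'a) \<Rightarrow> ('a \<Rightarrow> 'a::minus)" where
  "commutator D E = (\<lambda>a. D (E a) - E (D a))"

section \<open>The commutator on \<open>\<W>\<close> in coordinates\<close>

lemma lookup_scl: "Poly_Mapping.lookup (scl c a) k = c * Poly_Mapping.lookup a k"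
  unfolding scl_def by transfer (simp add: when_def)

lemma scl_single: "scl c (Poly_Mapping.single k d) = Poly_Mapping.single k (c * d)"
  by (rule poly_mapping_eqI) (simp add: lookup_scl lookup_single when_def)

lemma scl_add_left: "scl (c + d) a = scl c a + scl d a"
  by (rule poly_mapping_eqI) (simp add: lookup_scl lookup_add algebra_simps)

lemma scl_0 [simp]: "scl 0 a = 0"
  by (rule poly_mapping_eqI) (simp add: lookup_scl)

lemma lin_ext_superset:
  assumes "finite S" "Poly_Mapping.keys a \<subseteq> S"
  shows "lin_ext f a = (\<Sum>k\<in>S. scl (Poly_Mapping.lookup a k) (f k))"
  unfolding lin_ext_def using assms
  by (intro sum.mono_neutral_left) (auto simp: in_keys_iff)

lemma lin_ext_add: "lin_ext f (a + b) = lin_ext f a + lin_ext f b"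
proof -
  let ?S = "Poly_Mapping.keys a \<union> Poly_Mapping.keys b"
  have "Poly_Mapping.keys (a + b) \<subseteq> ?S" by (rule keys_add)
  then show ?thesis
    by (simp add: lin_ext_superset[of ?S] lookup_add scl_add_left sum.distrib)
qed

lemma lin_ext_single: "lin_ext f (Poly_Mapping.single k c) = scl c (f k)"
  by (simp add: lin_ext_superset[of "{k}"])

lemma partial_add: "partial \<phi> p (a + b) = partial \<phi> p a + partial \<phi> p b"
  by (simp add: partial_def d_phi_def d_hat_def lin_ext_add)

lemma partial_0 [simp]: "partial \<phi> p 0 = 0"
  using partial_add[of \<phi> p 0 0] by simp

lemma partial_sum: "partial \<phi> p (\<Sum>x\<in>S. f x) = (\<Sum>x\<in>S. partial \<phi> p (f x))"
  by (induction S rule: infinite_finite_induct) (simp_all add: partial_add)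

lemma partial_single: "partial \<phi> p (Poly_Mapping.single (\<alpha>, i) c) =
    Poly_Mapping.single (\<alpha>, i) (c * \<phi> p \<alpha>)
    + Poly_Mapping.single (\<alpha>, i - axis p 1) (c * of_nat (i $ p))"
  by (simp add: partial_def d_phi_def d_hat_def lin_ext_single scl_single)

lemma alg_induct [case_names zero single add]:
  assumes "P 0" "\<And>\<alpha> i c. P (Poly_Mapping.single (\<alpha>, i) c)"
    "\<And>a b. P a \<Longrightarrow> P b \<Longrightarrow> P (a + b)"
  shows "P (a :: ('g, 'n::finite, 'f::field) alg)"
proof (induction a rule: update_induct)
  case const
  then show ?case by (rule assms)
next
  case (update f a b)
  obtain \<alpha> i where a: "a = (\<alpha>, i)" by (cases a)
  have "Poly_Mapping.update a b f = f + Poly_Mapping.single a b"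
    using update by (intro poly_mapping_eqI)
      (auto simp: lookup_update lookup_add lookup_single when_def in_keys_iff)
  then show ?case using assms(2,3) update(3) a by metis
qed

lemma partial_mult:
  fixes \<phi> :: "'n::finite \<Rightarrow> 'g::ab_group_add \<Rightarrow> 'f::field"
  assumes "additive (\<phi> p)"
  shows "partial \<phi> p (a * b) = partial \<phi> p a * b + a * partial \<phi> p b"
proof (induction a rule: alg_induct)
  case (single \<alpha> i c)
  show ?case
  proof (induction b rule: alg_induct)
    case (single \<beta> j d)
    have 1: "Poly_Mapping.single (\<alpha> + \<beta>, i + j - axis p 1) (c * d * of_nat (i $ p))
        = Poly_Mapping.single (\<alpha> + \<beta>, i - axis p 1 + j) (c * d * of_nat (i $ p))"
    proof (cases "i $ p = 0")
      case False
      then have "i + j - axis p 1 = i - axis p 1 + j" by (auto simp: vec_eq_iff axis_def)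
      then show ?thesis by simp
    qed simp
    have 2: "Poly_Mapping.single (\<alpha> + \<beta>, i + j - axis p 1) (c * d * of_nat (j $ p))
        = Poly_Mapping.single (\<alpha> + \<beta>, i + (j - axis p 1)) (c * d * of_nat (j $ p))"
    proof (cases "j $ p = 0")
      case False
      then have "i + j - axis p 1 = i + (j - axis p 1)" by (auto simp: vec_eq_iff axis_def)
      then show ?thesis by simp
    qed simp
    show ?case
      using 1 2
      by (simp add: mult_single partial_single additive.add[OF assms] distrib_left distrib_right
          single_add mult.assoc mult.commute mult.left_commute add_ac)
  qed (simp_all add: partial_add algebra_simps)
qed (simp_all add: partial_add algebra_simps)

lemma partial_commute:
  fixes \<phi> :: "'n::finite \<Rightarrow> 'g::ab_group_add \<Rightarrow> 'f::field"
  shows "partial \<phi> p (partial \<phi> q a) = partial \<phi> q (partial \<phi> p a)"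
proof (induction a rule: alg_induct)
  case (single \<alpha> i c)
  define c2 where "c2 p q = c * of_nat (i $ p) * of_nat ((i - axis p (1::nat)) $ q)" for p q
  define i2 where "i2 p q = i - axis p 1 - axis q (1::nat)" for p q
  have 1: "i2 p q = i2 q p"
    by (simp add: i2_def vec_eq_iff add.commute)
  have "(i $ p) * ((i - axis p (1::nat)) $ q) = (i $ q) * ((i - axis q 1) $ p)"
    by (auto simp: axis_def)
  from arg_cong[OF this, of "of_nat :: nat \<Rightarrow> 'f"] have 2: "c2 p q = c2 q p"
    unfolding c2_def by (simp only: of_nat_mult mult.assoc)
  have D: "partial \<phi> r (partial \<phi> s (Poly_Mapping.single (\<alpha>, i) c)) =
      Poly_Mapping.single (\<alpha>, i) (c * \<phi> s \<alpha> * \<phi> r \<alpha>)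
      + Poly_Mapping.single (\<alpha>, i - axis r 1) (c * \<phi> s \<alpha> * of_nat (i $ r))
      + (Poly_Mapping.single (\<alpha>, i - axis s 1) (c * of_nat (i $ s) * \<phi> r \<alpha>)
      + Poly_Mapping.single (\<alpha>, i2 s r) (c2 s r))" for r s
    unfolding partial_single partial_add i2_def c2_def by (rule refl)
  have 3: "Poly_Mapping.single (\<alpha>, i2 q p) (c2 q p) = Poly_Mapping.single (\<alpha>, i2 p q) (c2 p q)"
    by (metis 1 2)
  show ?case
    unfolding D 3 by (simp add: mult_ac add_ac)
qed (simp_all add: partial_add)

lemma algA_0 [simp]: "0 \<in> algA J"
  by (simp add: algA_def)

lemma algA_add: "\<lbrakk>a \<in> algA J; b \<in> algA J\<rbrakk> \<Longrightarrow> a + b \<in> algA J"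
  using keys_add[of a b] unfolding algA_def by blast

lemma algA_sum: "(\<And>x. x \<in> S \<Longrightarrow> f x \<in> algA J) \<Longrightarrow> (\<Sum>x\<in>S. f x) \<in> algA J"
  by (induction S rule: infinite_finite_induct) (simp_all add: algA_add)

lemma algA_mult:
  assumes J: "\<forall>p. J p \<in> {{0}, UNIV}" and "a \<in> algA J" "b \<in> algA J"
  shows "(a :: ('g::ab_group_add, 'n::finite, 'f::field) alg) * b \<in> algA J"
proof -
  have "i $ p + j $ p \<in> J p" if "i $ p \<in> J p" "j $ p \<in> J p" for i j :: "nat ^ 'n" and p
    using J[rule_format, of p] that by auto
  then have "\<forall>p. (i + j) $ p \<in> J p"
    if "(\<alpha>, i) \<in> Poly_Mapping.keys a" "(\<beta>, j) \<in> Poly_Mapping.keys b" for \<alpha> \<beta> i j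
    using that assms(2,3) unfolding algA_def vector_add_component by blast
  then have "\<forall>(\<gamma>, k) \<in> {x + y | x y. x \<in> Poly_Mapping.keys a \<and> y \<in> Poly_Mapping.keys b}.
      \<forall>p. k $ p \<in> J p"
    by (auto simp del: vector_add_component)
  then show ?thesis
    using keys_mult[of a b] unfolding algA_def by blast
qed

lemma algA_partial:
  assumes J: "\<forall>p. J p \<in> {{0}, UNIV}" and a: "a \<in> algA J"
  shows "partial \<phi> p (a :: ('g::ab_group_add, 'n::finite, 'f::field) alg) \<in> algA J"
proof -
  have J': "(i - axis p 1) $ q \<in> J q" if "i $ q \<in> J q" for i :: "nat ^ 'n" and q
  proof (cases "J q = UNIV")
    case False
    then have "J q = {0}" using J by blast
    with that show ?thesis by simp
  qed simp
  have single: "Poly_Mapping.single (\<alpha>, i) c \<in> algA J" if "\<forall>q. i $ q \<in> J q"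
    for c :: 'f and \<alpha> :: 'g and i :: "nat ^ 'n"
    using that by (simp add: algA_def)
  have k: "\<forall>q. i $ q \<in> J q" if "(\<alpha>, i) \<in> Poly_Mapping.keys a" for \<alpha> i
    using a that unfolding algA_def by blast
  have "d_phi \<phi> p a \<in> algA J"
    unfolding d_phi_def lin_ext_def
  proof (rule algA_sum)
    fix x assume x: "x \<in> Poly_Mapping.keys a"
    obtain \<alpha> i where xi: "x = (\<alpha>, i)" by (cases x)
    have "\<forall>q. i $ q \<in> J q"
      using k[of \<alpha> i] x unfolding xi by simp
    then show "scl (Poly_Mapping.lookup a x) (case x of (\<alpha>, i) \<Rightarrow> scl (\<phi> p \<alpha>) (xpow \<alpha> i)) \<in> algA J"
      unfolding xi prod.case scl_single by (rule single)
  qed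
  moreover have "d_hat p a \<in> algA J"
    unfolding d_hat_def lin_ext_def
  proof (rule algA_sum)
    fix x assume x: "x \<in> Poly_Mapping.keys a"
    obtain \<alpha> i where xi: "x = (\<alpha>, i)" by (cases x)
    have "\<forall>q. (i - axis p 1) $ q \<in> J q"
      using J' k[of \<alpha> i] x unfolding xi by simp
    then show "scl (Poly_Mapping.lookup a x)
        (case x of (\<alpha>, i) \<Rightarrow> scl (of_nat (i $ p)) (xpow \<alpha> (i - axis p 1))) \<in> algA J"
      unfolding xi prod.case scl_single by (rule single)
  qed
  ultimately show ?thesis
    by (simp add: partial_def algA_add)
qed

theorem commutator_W_op:
  fixes J :: "'n::finite \<Rightarrow> nat set" and \<phi> :: "'n \<Rightarrow> 'g::ab_group_add \<Rightarrow> 'f::field"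
  assumes J: "\<forall>p. J p \<in> {{0}, UNIV}" and \<phi>: "\<forall>p. additive (\<phi> p)"
    and u: "\<forall>p. u p \<in> algA J" and v: "\<forall>p. v p \<in> algA J"
  shows "commutator (W_op J \<phi> u) (W_op J \<phi> v)
    = W_op J \<phi> (\<lambda>q. \<Sum>p\<in>UNIV. u p * partial \<phi> p (v q) - partial \<phi> p (u q) * v p)"
    (is "?L = ?R")
proof
  fix a
  have comp: "W_op J \<phi> f (W_op J \<phi> g a) = (\<Sum>q\<in>UNIV. \<Sum>p\<in>UNIV.
      f p * partial \<phi> p (g q) * partial \<phi> q a + f p * g q * partial \<phi> p (partial \<phi> q a))"
    if a: "a \<in> algA J" and g: "\<forall>p. g p \<in> algA J" for f g
  proof -
    have "(\<Sum>q\<in>UNIV. g q * partial \<phi> q a) \<in> algA J"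
      using a g by (intro algA_sum algA_mult[OF J] algA_partial[OF J]) auto
    then have "W_op J \<phi> f (W_op J \<phi> g a) = (\<Sum>p\<in>UNIV. \<Sum>q\<in>UNIV.
      f p * partial \<phi> p (g q) * partial \<phi> q a + f p * g q * partial \<phi> p (partial \<phi> q a))"
      using a \<phi> by (simp add: W_op_def partial_sum partial_mult sum_distrib_left algebra_simps)
    then show ?thesis by (subst sum.swap)
  qed
  show "?L a = ?R a"
  proof (cases "a \<in> algA J")
    case True
    let ?B = "\<lambda>f g. \<Sum>q\<in>UNIV. \<Sum>p\<in>UNIV. f p * partial \<phi> p (g q) * partial \<phi> q a"
    let ?C = "\<lambda>f g. \<Sum>q\<in>UNIV. \<Sum>p\<in>UNIV. f p * g q * partial \<phi> p (partial \<phi> q a)"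
    have "?C u v = ?C v u"
      by (subst sum.swap) (simp add: partial_commute mult_ac)
    then have "?L a = ?B u v - ?B v u"
      using True u v by (simp add: commutator_def comp sum.distrib)
    also have "\<dots> = ?R a"
      using True by (simp add: W_op_def sum_subtractf sum_distrib_left sum_distrib_right
          left_diff_distrib right_diff_distrib mult_ac)
    finally show ?thesis .
  next
    case False
    then show ?thesis by (simp add: commutator_def W_op_def)
  qed
qed

end

theory Submission
  imports Defs
begin

text \<open>
  Call a commutative ring \<open>R\<close> with a set \<open>L\<close> of derivations differentially simple if its only
  ideals stable under \<open>L\<close> are \<open>0\<close> and \<open>R\<close>. The proof separates two things: the algebra is
  differentially simple under \<open>\<W>\<close>, and a Lie ring \<open>L\<close> of derivations that is also a module
  over a differentially simple ring \<open>R\<close> of characteristic \<open>0\<close> has no proper nonzero ideals.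

  The second part is due to D. A. Jordan. Let \<open>I\<close> be an ideal of \<open>L\<close> and let
  \<open>D \<in> I\<close> be nonzero. Comparing \<open>[D, D(a)b D]\<close> with \<open>[D(a)D, bD]\<close> shows \<open>2b D\<^sup>2(a) D \<in> I\<close>
  for all \<open>a\<close> and \<open>b\<close>, so \<open>I\<close> contains the whole module \<open>R E\<close> with \<open>E = 2 D\<^sup>2(a) D\<close>. From
  \<open>E(c) F = [E, cF] - c[E, F]\<close> it follows that \<open>E(c)\<close> lies in \<open>K = {f. f L \<subseteq> I}\<close>, which is an
  ideal of \<open>R\<close> stable under \<open>L\<close>. So \<open>K\<close> contains \<open>1\<close> unless every \<open>E\<close> of this form vanishes; but
  then \<open>D(c)\<^sup>3 = 0\<close> for all \<open>c\<close>. That is excluded because \<open>R\<close> is reduced: in characteristic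
  \<open>0\<close> the nilpotent elements form an ideal stable under all derivations, and \<open>1\<close> is not nilpotent.
  These steps are the lemmas \<open>reduced\<close> and \<open>ideal_trivial\<close>.

  For the first part, \<open>\<partial>\<^sub>p - \<phi>\<^sub>p(\<alpha>)\<close> acts on the span of the \<open>x\<^bsup>\<alpha>,i\<^esup>\<close> with fixed \<open>\<alpha>\<close> by lowering
  exponents, so applying such operators to a nonzero element of a stable ideal shrinks the set of
  monomials at or below its support until a simultaneous eigenvector of all \<open>\<partial>\<^sub>p\<close> is reached. Since the \<open>\<phi>\<^sub>p\<close> have no common zero other than
  \<open>0\<close>, such an eigenvector is a multiple of some \<open>x\<^bsup>\<alpha>,0\<^esup>\<close>, which is invertible
  (\<open>stable_ideal_contains_one\<close>).
\<close>

section \<open>Lie rings of derivations of a differentially simple ring\<close>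

definition smul :: "'a::times \<Rightarrow> ('b \<Rightarrow> 'a) \<Rightarrow> 'b \<Rightarrow> 'a" where
  "smul a D = (\<lambda>x. a * D x)"

text \<open>
  \<open>R\<close> is a subring rather than a type, and a derivation of \<open>R\<close> is a function on the type that is \<open>0\<close>
  outside \<open>R\<close>, so that equality of functions is equality of derivations.
\<close>

locale derivation_simple =
  fixes R :: "'a::comm_ring_1 set" and L :: "('a \<Rightarrow> 'a) set"
  assumes R_one: "1 \<in> R"
    and R_diff: "\<lbrakk>a \<in> R; b \<in> R\<rbrakk> \<Longrightarrow> a - b \<in> R"
    and R_mult: "\<lbrakk>a \<in> R; b \<in> R\<rbrakk> \<Longrightarrow> a * b \<in> R"
    and R_torsion_free: "\<lbrakk>a \<in> R; of_nat k * a = 0; k > 0\<rbrakk> \<Longrightarrow> a = 0"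
    and L_closed: "\<lbrakk>D \<in> L; a \<in> R\<rbrakk> \<Longrightarrow> D a \<in> R"
    and L_outside: "\<lbrakk>D \<in> L; a \<notin> R\<rbrakk> \<Longrightarrow> D a = 0"
    and L_add: "\<lbrakk>D \<in> L; a \<in> R; b \<in> R\<rbrakk> \<Longrightarrow> D (a + b) = D a + D b"
    and L_Leibniz: "\<lbrakk>D \<in> L; a \<in> R; b \<in> R\<rbrakk> \<Longrightarrow> D (a * b) = D a * b + a * D b"
    and L_smul: "\<lbrakk>a \<in> R; D \<in> L\<rbrakk> \<Longrightarrow> smul a D \<in> L"
    and L_commutator: "\<lbrakk>D \<in> L; E \<in> L\<rbrakk> \<Longrightarrow> commutator D E \<in> L"
    and stable_ideal:
      "\<lbrakk>K \<subseteq> R; \<And>a b. \<lbrakk>a \<in> K; b \<in> K\<rbrakk> \<Longrightarrow> a + b \<in> K; \<And>a b. \<lbrakk>a \<in> R; b \<in> K\<rbrakk> \<Longrightarrow> a * b \<in> K;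
        \<And>D a. \<lbrakk>D \<in> L; a \<in> K\<rbrakk> \<Longrightarrow> D a \<in> K; x \<in> K; x \<noteq> 0\<rbrakk> \<Longrightarrow> 1 \<in> K"
begin

lemma R_zero: "0 \<in> R"
  using R_diff[OF R_one R_one] by simp

lemma R_add: "\<lbrakk>a \<in> R; b \<in> R\<rbrakk> \<Longrightarrow> a + b \<in> R"
  using R_diff[of a "0 - b"] R_diff[of 0 b] R_zero by simp

lemma R_power: "a \<in> R \<Longrightarrow> a ^ k \<in> R"
  by (induction k) (auto simp: R_one R_mult)

lemma R_of_nat: "of_nat k \<in> R"
  by (induction k) (auto simp: R_one R_zero R_add)

lemma L_zero: "D \<in> L \<Longrightarrow> D 0 = 0"
  using L_add[of D 0 0] R_zero by simp

lemma L_diff: "\<lbrakk>D \<in> L; a \<in> R; b \<in> R\<rbrakk> \<Longrightarrow> D (a - b) = D a - D b"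
  using L_add[of D "a - b" b] R_diff by (simp add: algebra_simps)

lemma commutator_smul_right:
  assumes "D \<in> L" "E \<in> L" "a \<in> R"
  shows "commutator D (smul a E) = smul (D a) E + smul a (commutator D E)"
proof
  fix x
  show "commutator D (smul a E) x = (smul (D a) E + smul a (commutator D E)) x"
    using assms L_outside[of D x] L_outside[of E x]
    by (cases "x \<in> R") (auto simp: commutator_def smul_def L_Leibniz L_closed L_zero algebra_simps)
qed

lemma commutator_smul_left:
  assumes "D \<in> L" "E \<in> L" "a \<in> R"
  shows "commutator (smul a D) E = smul a (commutator D E) - smul (E a) D"
proof
  fix x
  show "commutator (smul a D) E x = (smul a (commutator D E) - smul (E a) D) x"
    using assms L_outside[of D x] L_outside[of E x]
    by (cases "x \<in> R") (auto simp: commutator_def smul_def L_Leibniz L_closed L_zero algebra_simps)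
qed

lemma commutator_add_left:
  assumes "D \<in> L" "E \<in> L" "F \<in> L"
  shows "commutator (D + E) F = commutator D F + commutator E F"
proof
  fix x
  show "commutator (D + E) F x = (commutator D F + commutator E F) x"
    using assms L_outside[of D x] L_outside[of E x] L_outside[of F x]
    by (cases "x \<in> R") (auto simp: commutator_def L_add L_closed L_zero algebra_simps)
qed

lemma commutator_add_right:
  assumes "D \<in> L" "E \<in> L" "F \<in> L"
  shows "commutator D (E + F) = commutator D E + commutator D F"
  using commutator_add_left[OF assms(2,3,1)]
  by (auto simp: commutator_def fun_eq_iff algebra_simps)

lemma commutator_jacobi:
  assumes "D \<in> L" "E \<in> L" "F \<in> L"
  shows "commutator D (commutator E F) + commutator E (commutator F D)
    + commutator F (commutator D E) = 0"
proof
  fix x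
  show "(commutator D (commutator E F) + commutator E (commutator F D)
    + commutator F (commutator D E)) x = 0 x"
    using assms L_outside[of D x] L_outside[of E x] L_outside[of F x]
    by (cases "x \<in> R") (auto simp: commutator_def L_diff L_closed L_zero algebra_simps)
qed

subsection \<open>Reducedness\<close>

text \<open>The power rule multiplied by \<open>a\<close>, which avoids the exponent \<open>k - 1\<close> at \<open>k = 0\<close>.\<close>

lemma derivation_power:
  assumes "D \<in> L" "a \<in> R"
  shows "a * D (a ^ k) = of_nat k * a ^ k * D a"
proof (induction k)
  case 0
  have "D 1 = 0"
    using L_Leibniz[OF assms(1) R_one R_one] by simp
  then show ?case by simp
next
  case (Suc k)
  have "a * D (a ^ Suc k) = a * a ^ k * D a + a * (a * D (a ^ k))"
    using assms by (simp add: L_Leibniz R_power algebra_simps)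
  then show ?case
    by (simp add: Suc algebra_simps)
qed

text \<open>
  Applying \<open>D\<close> to \<open>a\<^bsup>m+1\<^esup> D(a)\<^bsup>e\<^esup> = 0\<close> and multiplying by \<open>D(a)\<close> gives
  \<open>(m + 1) a\<^bsup>m\<^esup> D(a)\<^bsup>e+2\<^esup> = 0\<close>, since the other term contains the factor that vanishes. So one factor
  \<open>a\<close> can be traded for two factors \<open>D(a)\<close> until no \<open>a\<close> is left; with \<open>e = 0\<close>, derivations preserve
  nilpotency.
\<close>

lemma derivation_of_nilpotent:
  assumes "D \<in> L" "a \<in> R"
  shows "a ^ m * D a ^ e = 0 \<Longrightarrow> D a ^ (e + 2 * m) = 0"
proof (induction m arbitrary: e)
  case (Suc m)
  let ?d = "D a"
  have d: "?d \<in> R" using assms by (simp add: L_closed)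
  have "0 = ?d * D (a * a ^ m * ?d ^ e)"
    using Suc.prems assms by (simp add: L_zero)
  also have "\<dots> = ?d * ?d ^ e * (a ^ m * ?d + a * D (a ^ m)) + a ^ Suc m * (?d * D (?d ^ e))"
    using assms d by (simp add: L_Leibniz R_power R_mult algebra_simps)
  also have "\<dots> = of_nat (Suc m) * (a ^ m * ?d ^ (e + 2))
      + of_nat e * D ?d * (a ^ Suc m * ?d ^ e)"
    using assms d by (simp add: derivation_power algebra_simps)
  finally have "of_nat (Suc m) * (a ^ m * ?d ^ (e + 2)) = 0"
    using Suc.prems by simp
  then have "a ^ m * ?d ^ (e + 2) = 0"
    by (rule R_torsion_free[of _ "Suc m", rotated]) (simp_all add: assms d R_mult R_power)
  from Suc.IH[OF this] show ?case by (simp add: algebra_simps)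
qed simp

lemma nilpotent_add:
  fixes a b :: 'a
  assumes "a ^ k = 0" "b ^ l = 0"
  shows "(a + b) ^ (k + l) = 0"
proof -
  have "a ^ j * b ^ (k + l - j) = 0" for j
  proof (cases "k \<le> j")
    case True
    then show ?thesis using assms(1) by (metis le_iff_add mult_zero_left power_add)
  next
    case False
    then have "l \<le> k + l - j" by simp
    then show ?thesis using assms(2) by (metis le_iff_add mult_zero_left mult_zero_right power_add)
  qed
  then show ?thesis
    by (auto simp: binomial_ring mult.assoc intro!: sum.neutral)
qed

text \<open>The nilradical is a stable ideal without \<open>1\<close>.\<close>

lemma reduced:
  assumes "a \<in> R" "a ^ k = 0"
  shows "a = 0"
proof (rule ccontr)
  assume "a \<noteq> 0"
  define N where "N = {b \<in> R. \<exists>k. b ^ k = 0}"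
  have "1 \<in> N"
  proof (rule stable_ideal)
    show "N \<subseteq> R" by (auto simp: N_def)
    show "b + c \<in> N" if "b \<in> N" "c \<in> N" for b c
      using that nilpotent_add by (fastforce simp: N_def R_add)
    show "b * c \<in> N" if "b \<in> R" "c \<in> N" for b c
      proof -
      obtain m where "c ^ m = 0" using \<open>c \<in> N\<close> by (auto simp: N_def)
      then have "(b * c) ^ m = 0" by (simp add: power_mult_distrib)
      then show ?thesis using that by (auto simp: N_def R_mult)
    qed
    show "D b \<in> N" if D: "D \<in> L" and b: "b \<in> N" for D b
    proof -
      obtain m where "b \<in> R" "b ^ m = 0" using b by (auto simp: N_def)
      then show ?thesis
        using derivation_of_nilpotent[OF D, of b m 0] D by (auto simp: N_def L_closed)
    qed
    show "a \<in> N" using assms by (auto simp: N_def)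
  qed fact
  then show False by (auto simp: N_def)
qed

lemma derivation_eqI_zero:
  assumes "D \<in> L" "\<And>a. a \<in> R \<Longrightarrow> D a ^ k = 0"
  shows "D = 0"
proof
  fix x
  show "D x = 0 x"
    using reduced[of "D x" k] assms L_outside[of D x] by (cases "x \<in> R") (auto simp: L_closed)
qed

subsection \<open>Simplicity\<close>

text \<open>In an abelian \<open>L\<close>, \<open>0 = [D, aD] = D(a) D\<close>; evaluated at \<open>a\<close> this makes every \<open>D(a)\<close> nilpotent.\<close>

lemma not_abelian:
  assumes D: "D \<in> L" "D \<noteq> 0"
  shows "\<exists>D\<in>L. \<exists>E\<in>L. commutator D E \<noteq> 0"
proof (rule ccontr)
  assume ab: "\<not> ?thesis"
  have "D a ^ 2 = 0" if a: "a \<in> R" for a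
  proof -
    have "commutator D (smul a D) = smul (D a) D"
      using D a by (simp add: commutator_smul_right) (simp add: commutator_def smul_def fun_eq_iff)
    then have "smul (D a) D = 0"
      using ab D a L_smul by metis
    then have "smul (D a) D a = 0" by simp
    then show ?thesis by (simp add: smul_def power2_eq_square)
  qed
  then show False using derivation_eqI_zero D by blast
qed

text \<open>
  Any nonzero \<open>D \<in> I\<close> produces a nonzero \<open>E\<close> with \<open>R E \<subseteq> I\<close>, and any such \<open>E\<close> produces nonzero elements
  \<open>E(c)\<close> of the stable ideal \<open>K = {f. f L \<subseteq> I}\<close>. Hence \<open>1 \<in> K\<close>, that is, \<open>L \<subseteq> I\<close>.
\<close>

lemma ideal_trivial:
  assumes I_sub: "I \<subseteq> L"
    and I_diff: "\<And>D E. \<lbrakk>D \<in> I; E \<in> I\<rbrakk> \<Longrightarrow> D - E \<in> I"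
    and I_comm: "\<And>D E. \<lbrakk>D \<in> L; E \<in> I\<rbrakk> \<Longrightarrow> commutator D E \<in> I"
    and D: "D \<in> I" "D \<noteq> 0"
  shows "I = L"
proof -
  have I_zero: "0 \<in> I" using I_diff[OF D(1) D(1)] by simp
  have I_add: "E + F \<in> I" if "E \<in> I" "F \<in> I" for E F
    using I_diff[OF that(1) I_diff[OF I_zero that(2)]] by simp
  have I_comm': "commutator E F \<in> I" if "E \<in> I" "F \<in> L" for E F
  proof -
    have "commutator E F = 0 - commutator F E" by (simp add: commutator_def fun_eq_iff)
    then show ?thesis using I_diff[OF I_zero I_comm[OF that(2,1)]] by simp
  qed
  have DL: "D \<in> L" using D I_sub by blast
  have comm_self: "commutator D (smul a D) = smul (D a) D" if "a \<in> R" for a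
    using DL that by (simp add: commutator_smul_right) (simp add: commutator_def smul_def fun_eq_iff)
  \<comment> \<open>Both \<open>[D, gbD]\<close> and \<open>[gD, bD]\<close> contain \<open>g D(b) D\<close>; the remaining terms are \<open>b D(g) D\<close> with
    opposite signs, so the difference doubles it.\<close>
  have key: "smul (b * (2 * D (D a))) D \<in> I" if a: "a \<in> R" and b: "b \<in> R" for a b
  proof -
    let ?g = "D a"
    have g: "?g \<in> R" using a DL by (simp add: L_closed)
    have "smul ?g D \<in> I"
      using I_comm'[OF D(1) L_smul[OF a DL]] comm_self[OF a] by simp
    then have "commutator (smul ?g D) (smul b D) \<in> I"
      by (rule I_comm'[OF _ L_smul[OF b DL]])
    moreover have "commutator D (smul (?g * b) D) \<in> I"
      using I_comm'[OF D(1)] L_smul[OF R_mult[OF g b] DL] .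
    moreover have "commutator D (smul (?g * b) D) - commutator (smul ?g D) (smul b D)
        = smul (b * (2 * D ?g)) D"
    proof -
      have 1: "commutator D (smul (?g * b) D) = smul (D ?g * b + ?g * D b) D"
        using comm_self[OF R_mult[OF g b]] L_Leibniz[OF DL g b] by simp
      have 2: "commutator (smul ?g D) (smul b D) = smul ?g (smul (D b) D) - smul (b * D ?g) D"
        using commutator_smul_left[OF DL L_smul[OF b DL] g] comm_self[OF b]
        by (simp add: smul_def)
      show ?thesis
        unfolding 1 2 by (simp add: smul_def fun_eq_iff algebra_simps)
    qed
    ultimately show ?thesis using I_diff by fastforce
  qed
  have "\<exists>a\<in>R. smul (2 * D (D a)) D \<noteq> 0"
  proof (rule ccontr)
    assume "\<not> ?thesis"
    \<comment> \<open>Taking \<open>a = c\<^sup>2\<close> and using the same identity for \<open>a = c\<close> leaves only \<open>4 D(c)\<^sup>3\<close>.\<close>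
    then have z: "2 * D (D a) * D c = 0" if "a \<in> R" for a c
      using that by (auto simp: smul_def fun_eq_iff)
    have "D c ^ 3 = 0" if c: "c \<in> R" for c
    proof -
      have Dc: "D c \<in> R" using DL c by (simp add: L_closed)
      have Dcc: "D (c * c) = c * D c + c * D c"
        using DL c by (simp only: L_Leibniz) (simp add: mult.commute)
      have "D (D (c * c)) = 2 * (D c * D c) + 2 * (c * D (D c))"
        unfolding Dcc L_add[OF DL R_mult[OF c Dc] R_mult[OF c Dc]] L_Leibniz[OF DL c Dc]
        by (simp add: algebra_simps)
      then have "of_nat 4 * D c ^ 3 = 2 * D (D (c * c)) * D c - 2 * c * (2 * D (D c) * D c)"
        by (simp add: algebra_simps power3_eq_cube)
      then have "of_nat 4 * D c ^ 3 = 0"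
        using z[OF c, of c] z[OF R_mult[OF c c], of c] by simp
      then show ?thesis
        using R_torsion_free[of "D c ^ 3" 4] R_power[OF Dc] by simp
    qed
    then show False using derivation_eqI_zero[OF DL] D(2) by blast
  qed
  then obtain a where a: "a \<in> R" "smul (2 * D (D a)) D \<noteq> 0" by blast
  define E where "E = smul (2 * D (D a)) D"
  have RL: "2 * D (D a) \<in> R"
    using R_mult[OF R_of_nat[of 2]] a DL by (simp add: L_closed)
  have EL: "E \<in> L" using RL DL by (simp add: E_def L_smul)
  have EM: "smul b E \<in> I" if "b \<in> R" for b
    using key[OF a(1) that] by (simp add: E_def smul_def mult.assoc)
  have EI: "E \<in> I" using EM[OF R_one] by (simp add: smul_def)
  define K where "K = {f \<in> R. \<forall>F\<in>L. smul f F \<in> I}"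
  have EK: "E c \<in> K" if c: "c \<in> R" for c
  proof -
    have "smul (E c) F \<in> I" if F: "F \<in> L" for F
    proof -
      have "smul c (commutator E F) = commutator (smul c E) F + smul (F c) E"
        using commutator_smul_left[OF EL F c] by simp
      then have "smul c (commutator E F) \<in> I"
        using I_add I_comm'[OF EM[OF c] F] EM[OF L_closed[OF F c]] by simp
      moreover have "smul (E c) F = commutator E (smul c F) - smul c (commutator E F)"
        using commutator_smul_right[OF EL F c] by simp
      ultimately show ?thesis
        using I_diff I_comm'[OF EI L_smul[OF c F]] by simp
    qed
    then show ?thesis using L_closed[OF EL c] by (simp add: K_def)
  qed
  obtain c where c: "c \<in> R" "E c \<noteq> 0"
    using a(2) L_outside[OF EL] unfolding E_def[symmetric] by (metis ext zero_fun_apply)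
  have "1 \<in> K"
  proof (rule stable_ideal)
    show "K \<subseteq> R" by (auto simp: K_def)
    show "f + g \<in> K" if "f \<in> K" "g \<in> K" for f g
    proof -
      have "smul (f + g) F = smul f F + smul g F" for F :: "'a \<Rightarrow> 'a"
        by (simp add: smul_def fun_eq_iff algebra_simps)
      then show ?thesis using that by (auto simp: K_def R_add I_add)
    qed
    show "b * f \<in> K" if "b \<in> R" "f \<in> K" for b f
    proof -
      have "smul (b * f) F = smul f (smul b F)" for F :: "'a \<Rightarrow> 'a"
        by (simp add: smul_def fun_eq_iff algebra_simps)
      then show ?thesis using that by (auto simp: K_def R_mult L_smul)
    qed
    show "F f \<in> K" if F: "F \<in> L" and f: "f \<in> K" for F f
    proof -
      have fR: "f \<in> R" and fI: "\<And>G. G \<in> L \<Longrightarrow> smul f G \<in> I" using f by (auto simp: K_def)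
      have "smul (F f) G \<in> I" if G: "G \<in> L" for G
      proof -
        have "smul (F f) G = commutator F (smul f G) - smul f (commutator F G)"
          using commutator_smul_right[OF F G fR] by simp
        then show ?thesis
          using I_diff[OF I_comm[OF F fI[OF G]] fI[OF L_commutator[OF F G]]] by simp
      qed
      then show ?thesis using L_closed[OF F fR] by (simp add: K_def)
    qed
    show "E c \<in> K" "E c \<noteq> 0" using EK c by auto
  qed
  then have "F \<in> I" if "F \<in> L" for F
    using that by (force simp: K_def smul_def)
  then show ?thesis using I_sub by blast
qed

end

section \<open>Differential simplicity of the algebra\<close>

lemma exponent_lower_0: "j $ p = 0 \<Longrightarrow> j - axis p 1 = (j :: nat ^ 'n::finite)"
  by (simp add: vec_eq_iff axis_def)

lemma exponent_lower_raise: "j $ p \<noteq> 0 \<Longrightarrow> j - axis p 1 + axis p 1 = (j :: nat ^ 'n::finite)"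
  by (simp add: vec_eq_iff axis_def)

lemma lookup_partial:
  fixes a :: "('g::ab_group_add, 'n::finite, 'f::field) alg"
  shows "Poly_Mapping.lookup (partial \<phi> p a) (\<alpha>, i) = \<phi> p \<alpha> * Poly_Mapping.lookup a (\<alpha>, i)
    + of_nat (Suc (i $ p)) * Poly_Mapping.lookup a (\<alpha>, i + axis p 1)"
proof (induction a rule: alg_induct)
  case (single \<beta> j c)
  have eq: "j - axis p 1 = i \<and> j $ p \<noteq> 0 \<longleftrightarrow> j = i + axis p 1"
    using exponent_lower_raise[of j p] by (auto simp: vec_eq_iff axis_def)
  show ?case
  proof (cases "j = i + axis p 1")
    case True
    then show ?thesis
      by (auto simp: partial_single lookup_add lookup_single when_def axis_def)
  next
    case False
    then have "j - axis p 1 \<noteq> i \<or> j $ p = 0" using eq by blast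
    then show ?thesis using False
      by (auto simp: partial_single lookup_add lookup_single when_def)
  qed
qed (simp_all add: partial_add lookup_add algebra_simps)

lemma scl_eq_mult:
  fixes a :: "('g::ab_group_add, 'n::finite, 'f::field) alg"
  shows "scl c a = Poly_Mapping.single 0 c * a"
proof (induction a rule: alg_induct)
  case zero
  show ?case by (rule poly_mapping_eqI) (simp add: lookup_scl)
next
  case (single \<alpha> i d)
  show ?case by (simp add: scl_single mult_single)
next
  case (add a b)
  have "scl c (a + b) = scl c a + scl c b"
    by (rule poly_mapping_eqI) (simp add: lookup_scl lookup_add algebra_simps)
  then show ?case using add by (simp add: algebra_simps)
qed

lemma finite_exponent_box: "finite {j :: nat ^ 'n::finite. \<forall>p. j $ p \<le> N}"
proof -
  have "{j :: nat ^ 'n. \<forall>p. j $ p \<le> N} \<subseteq> vec_lambda ` PiE UNIV (\<lambda>_. {..N})"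
  proof
    fix j :: "nat ^ 'n" assume "j \<in> {j. \<forall>p. j $ p \<le> N}"
    then have "vec_nth j \<in> PiE UNIV (\<lambda>_. {..N})" by auto
    then show "j \<in> vec_lambda ` PiE UNIV (\<lambda>_. {..N})" by (metis image_eqI vec_nth_inverse)
  qed
  then show ?thesis by (rule finite_subset) (intro finite_imageI finite_PiE, auto)
qed

text \<open>
  Comparing coefficients at \<open>(\<beta>, j)\<close> with the eigenvalue \<open>\<phi>\<^sub>p(\<beta>)\<close>, for \<open>\<beta>\<close> in the support, kills the
  coefficient at \<open>(\<beta>, j + 1\<^sub>p)\<close>, so only exponents \<open>j = 0\<close> occur. Comparing eigenvalues for two
  group elements \<open>\<alpha>\<close> and \<open>\<beta>\<close> in the support then gives \<open>\<phi>\<^sub>p(\<alpha>) = \<phi>\<^sub>p(\<beta>)\<close> for all \<open>p\<close>.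
\<close>

lemma single_of_simultaneous_eigenvector:
  fixes a :: "('g::ab_group_add, 'n::finite, 'f::field_char_0) alg"
  assumes hom: "\<forall>p. Modules.additive (\<phi> p)"
    and separating: "(\<Inter>p. ker (\<phi> p)) = {0}"
    and "a \<noteq> 0"
    and eigen: "\<And>p \<alpha> i. (\<alpha>, i) \<in> Poly_Mapping.keys a \<Longrightarrow> partial \<phi> p a = scl (\<phi> p \<alpha>) a"
  obtains \<alpha> c where "c \<noteq> 0" "a = Poly_Mapping.single (\<alpha>, 0) c"
proof -
  have lk: "\<phi> p \<beta> * Poly_Mapping.lookup a (\<beta>, j)
      + of_nat (Suc (j $ p)) * Poly_Mapping.lookup a (\<beta>, j + axis p 1)
      = \<phi> p \<alpha> * Poly_Mapping.lookup a (\<beta>, j)"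
    if "(\<alpha>, i) \<in> Poly_Mapping.keys a" for p \<alpha> i \<beta> j
    using eigen[OF that, of p] lookup_partial[of \<phi> p a \<beta> j] by (simp add: lookup_scl)
  have shift: "Poly_Mapping.lookup a (\<beta>, j + axis p 1) = 0"
    if "(\<beta>, i) \<in> Poly_Mapping.keys a" for \<beta> i j p
    using lk[OF that, of p \<beta> j] by (simp del: of_nat_Suc)
  have zero: "j = 0" if k: "(\<beta>, j) \<in> Poly_Mapping.keys a" for \<beta> j
  proof (rule ccontr)
    assume "j \<noteq> 0"
    then obtain p where "j $ p \<noteq> 0" by (auto simp: vec_eq_iff)
    then have "j = (j - axis p 1) + axis p 1" by (rule exponent_lower_raise[symmetric])
    then have "Poly_Mapping.lookup a (\<beta>, j) = 0" using shift[OF k, of "j - axis p 1" p] by simp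
    with k show False by (simp add: in_keys_iff)
  qed
  obtain \<alpha> i where "(\<alpha>, i) \<in> Poly_Mapping.keys a"
    using \<open>a \<noteq> 0\<close> by (metis all_not_in_conv keys_eq_empty surj_pair)
  then have \<alpha>: "(\<alpha>, 0) \<in> Poly_Mapping.keys a" using zero by metis
  have "\<beta> = \<alpha>" if k: "(\<beta>, j) \<in> Poly_Mapping.keys a" for \<beta> j
  proof -
    have "\<phi> p (\<beta> - \<alpha>) = 0" for p
      using lk[OF \<alpha>, of p \<beta> j] shift[OF k, of j p] k hom by (simp add: in_keys_iff additive.diff)
    then have "\<beta> - \<alpha> \<in> (\<Inter>p. ker (\<phi> p))" by (simp add: ker_def)
    then show ?thesis using separating by simp
  qed
  then have "Poly_Mapping.lookup a x
      = Poly_Mapping.lookup (Poly_Mapping.single (\<alpha>, 0) (Poly_Mapping.lookup a (\<alpha>, 0))) x" for x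
    using zero by (cases x) (metis in_keys_iff lookup_single_eq lookup_single_not_eq)
  then have "a = Poly_Mapping.single (\<alpha>, 0) (Poly_Mapping.lookup a (\<alpha>, 0))"
    by (rule poly_mapping_eqI)
  then show thesis using that \<alpha> by (metis in_keys_iff)
qed

text \<open>
  The support itself need not shrink under \<open>\<partial>\<^sub>p - \<phi>\<^sub>p(\<alpha>)\<close>, because lowering exponents may create new
  monomials. The induction is therefore on the size of a finite set \<open>S\<close> that contains the
  support and is closed under lowering exponents. Every operator \<open>\<partial>\<^sub>p - c\<close> keeps the support inside
  \<open>S\<close>, and \<open>\<partial>\<^sub>p - \<phi>\<^sub>p(\<alpha>)\<close> removes \<open>(\<alpha>, i)\<close> from it when \<open>i\<close> has maximal degree among the exponents
  at \<open>\<alpha>\<close> in \<open>S\<close>: the coefficient there is \<open>\<phi>\<^sub>p(\<alpha>) - \<phi>\<^sub>p(\<alpha>) = 0\<close> times the old one plus a multiple of the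
  coefficient at \<open>(\<alpha>, i + 1\<^sub>p)\<close>, which is not in \<open>S\<close>. By maximality \<open>S - {(\<alpha>, i)}\<close> is still closed.
\<close>

lemma stable_ideal_contains_one:
  fixes J :: "'n::finite \<Rightarrow> nat set" and \<phi> :: "'n \<Rightarrow> 'g::ab_group_add \<Rightarrow> 'f::field_char_0"
  assumes J: "\<forall>p. J p \<in> {{0}, UNIV}"
    and hom: "\<forall>p. Modules.additive (\<phi> p)"
    and separating: "(\<Inter>p. ker (\<phi> p)) = {0}"
    and add: "\<And>a b. \<lbrakk>a \<in> K; b \<in> K\<rbrakk> \<Longrightarrow> a + b \<in> K"
    and mult: "\<And>a b. \<lbrakk>a \<in> algA J; b \<in> K\<rbrakk> \<Longrightarrow> a * b \<in> K"
    and stable: "\<And>p a. a \<in> K \<Longrightarrow> partial \<phi> p a \<in> K"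
    and a: "a \<in> K" "a \<noteq> 0"
  shows "1 \<in> K"
proof -
  have zeroJ: "0 \<in> J p" for p using J[rule_format, of p] by auto
  have mono: "Poly_Mapping.single (\<alpha>, 0) c \<in> algA J" for \<alpha> :: 'g and c :: 'f
    using zeroJ by (simp add: algA_def)
  have scl: "scl c b \<in> K" if "b \<in> K" for c b
    using mult[OF mono[of 0 c] that] by (simp add: scl_eq_mult zero_prod_def)
  have ind: "1 \<in> K"
    if "finite S" "\<And>\<alpha> i p. (\<alpha>, i) \<in> S \<Longrightarrow> (\<alpha>, i - axis p 1) \<in> S"
      "Poly_Mapping.keys b \<subseteq> S" "b \<in> K" "b \<noteq> 0" for S b
    using that
  proof (induction "card S" arbitrary: S b rule: less_induct)
    case less
    show ?case
    proof (cases "\<exists>p \<alpha> i. (\<alpha>, i) \<in> Poly_Mapping.keys b \<and> partial \<phi> p b \<noteq> scl (\<phi> p \<alpha>) b")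
      case True
      then obtain p \<alpha> i0 where i0: "(\<alpha>, i0) \<in> Poly_Mapping.keys b"
        and ne: "partial \<phi> p b \<noteq> scl (\<phi> p \<alpha>) b" by blast
      define deg where "deg j = (\<Sum>q\<in>UNIV. j $ q)" for j :: "nat ^ 'n"
      define b' where "b' = partial \<phi> p b + scl (-1) (scl (\<phi> p \<alpha>) b)"
      have lookup_b': "Poly_Mapping.lookup b' (\<beta>, j) = (\<phi> p \<beta> - \<phi> p \<alpha>) * Poly_Mapping.lookup b (\<beta>, j)
          + of_nat (Suc (j $ p)) * Poly_Mapping.lookup b (\<beta>, j + axis p 1)" for \<beta> j
        by (simp add: b'_def lookup_add lookup_partial lookup_scl algebra_simps)
      have vanish: "Poly_Mapping.lookup b x = 0" if "x \<notin> S" for x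
        using that less.prems(3) by (auto simp: in_keys_iff)
      let ?T = "{i. (\<alpha>, i) \<in> S}"
      have "finite ?T"
        using finite_imageI[OF less.prems(1), of snd] by (rule rev_finite_subset) force
      moreover have "?T \<noteq> {}" using i0 less.prems(3) by auto
      ultimately obtain i where i: "(\<alpha>, i) \<in> S" and max: "\<And>j. (\<alpha>, j) \<in> S \<Longrightarrow> deg j \<le> deg i"
        using finite_imageI[of ?T deg] Max_in[of "deg ` ?T"] Max_ge[of "deg ` ?T"] by fastforce
      have deg_shift: "deg (j + axis q 1) = Suc (deg j)" for j q
        by (simp add: deg_def sum.distrib axis_def)
      have shift: "(\<alpha>, i + axis q 1) \<notin> S" for q
        using max[of "i + axis q 1"] deg_shift[of i q] by auto
      let ?S = "S - {(\<alpha>, i)}"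
      show ?thesis
      proof (rule less.hyps)
        show "card ?S < card S" using i less.prems(1) by (metis card_Diff1_less)
        show "finite ?S" using less.prems(1) by simp
        show "(\<beta>, j - axis q 1) \<in> ?S" if j: "(\<beta>, j) \<in> ?S" for \<beta> j q
        proof (rule ccontr)
          assume "(\<beta>, j - axis q 1) \<notin> ?S"
          then have e: "\<beta> = \<alpha>" "j - axis q 1 = i" using j less.prems(2)[of \<beta> j q] by auto
          then have "j \<noteq> i" using j by auto
          then have "j $ q \<noteq> 0" using e(2) exponent_lower_0 by metis
          then have "j = i + axis q 1" using e(2) exponent_lower_raise by metis
          then show False using shift[of q] j e by simp
        qed
        show "Poly_Mapping.keys b' \<subseteq> ?S"
        proof (intro subsetI)
          fix x assume x: "x \<in> Poly_Mapping.keys b'"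
          obtain \<beta> j where xj: "x = (\<beta>, j)" by (cases x)
          have S: "(\<beta>, j) \<in> S"
          proof (rule ccontr)
            assume n: "(\<beta>, j) \<notin> S"
            then have "(\<beta>, j + axis p 1) \<notin> S"
              using less.prems(2)[of \<beta> "j + axis p 1" p] by auto
            then have "Poly_Mapping.lookup b' (\<beta>, j) = 0"
              using n by (simp add: lookup_b' vanish)
            then show False using x xj by (simp add: in_keys_iff)
          qed
          have "Poly_Mapping.lookup b' (\<alpha>, i) = 0"
            using shift[of p] by (simp add: lookup_b' vanish)
          then show "x \<in> ?S" using S x xj by (auto simp: in_keys_iff)
        qed
        show "b' \<in> K" unfolding b'_def using less.prems(4) by (intro add scl stable)
        show "b' \<noteq> 0"
        proof
          assume "b' = 0"
          then have "Poly_Mapping.lookup b' x = 0" for x by simp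
          then have "partial \<phi> p b = scl (\<phi> p \<alpha>) b"
            by (intro poly_mapping_eqI) (simp add: b'_def lookup_add lookup_scl)
          then show False using ne by simp
        qed
      qed
    next
      case False
      then obtain \<alpha> c where c: "c \<noteq> 0" "b = Poly_Mapping.single (\<alpha>, 0) c"
        using single_of_simultaneous_eigenvector[OF hom separating less.prems(5)] by metis
      have "Poly_Mapping.single (- \<alpha>, 0) (inverse c) * b = 1"
        using c by (simp add: mult_single single_one flip: zero_prod_def)
      then show ?thesis using mult[OF mono less.prems(4)] by metis
    qed
  qed
  define N where "N = Max (insert 0 (\<Union>(\<alpha>, i)\<in>Poly_Mapping.keys a. range (($) i)))"
  have bound: "i $ p \<le> N" if "(\<alpha>, i) \<in> Poly_Mapping.keys a" for \<alpha> i p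
    unfolding N_def using that by (intro Max_ge) auto
  show ?thesis
  proof (rule ind)
    let ?S = "fst ` Poly_Mapping.keys a \<times> {j. \<forall>p. j $ p \<le> N}"
    show "finite ?S" by (intro finite_cartesian_product finite_imageI finite_exponent_box) simp
    show "(\<alpha>, i - axis p 1) \<in> ?S" if "(\<alpha>, i) \<in> ?S" for \<alpha> i p
      using that by (auto simp: le_diff_conv intro: le_trans trans_le_add1)
    show "Poly_Mapping.keys a \<subseteq> ?S" using bound by force
  qed fact+
qed

section \<open>The Lie algebra \<open>\<W>\<close>\<close>

lemma scl_in_algA: "a \<in> algA J \<Longrightarrow> scl c a \<in> algA J"
  by (fastforce simp: algA_def in_keys_iff lookup_scl)

lemma algA_diff:
  fixes a :: "('g, 'n::finite, 'f::field) alg"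
  assumes "a \<in> algA J" "b \<in> algA J"
  shows "a - b \<in> algA J"
proof -
  have "a - b = a + scl (-1) b"
    by (rule poly_mapping_eqI) (simp add: lookup_add lookup_minus lookup_scl)
  then show ?thesis using assms by (metis algA_add scl_in_algA)
qed

lemma partial_scl:
  fixes a :: "('g::ab_group_add, 'n::finite, 'f::field) alg"
  shows "partial \<phi> p (scl c a) = scl c (partial \<phi> p a)"
  by (rule poly_mapping_eqI) (auto simp: lookup_partial lookup_scl algebra_simps)

lemma W_op_scl_arg:
  assumes "a \<in> algA J"
  shows "W_op J \<phi> u (scl c a) = scl c (W_op J \<phi> u a)"
proof -
  have "W_op J \<phi> u (scl c a) = (\<Sum>p\<in>UNIV. u p * scl c (partial \<phi> p a))"
    using assms by (simp add: W_op_def scl_in_algA partial_scl)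
  also have "\<dots> = scl c (W_op J \<phi> u a)"
    using assms by (simp add: W_op_def scl_eq_mult sum_distrib_left mult.left_commute)
  finally show ?thesis .
qed

lemma of_nat_mult_eq_scl:
  fixes a :: "('g::ab_group_add, 'n::finite, 'f::field) alg"
  shows "of_nat k * a = scl (of_nat k) a"
  by (induction k) (simp_all add: algebra_simps scl_add_left, simp add: scl_eq_mult)

lemma W_derivation_simple:
  fixes J :: "'n::finite \<Rightarrow> nat set" and \<phi> :: "'n \<Rightarrow> 'g::ab_group_add \<Rightarrow> 'f::field_char_0"
  assumes J: "\<forall>p. J p \<in> {{0}, UNIV}"
    and hom: "\<forall>p. Modules.additive (\<phi> p)"
    and separating: "(\<Inter>p. ker (\<phi> p)) = {0}"
  shows "derivation_simple (algA J) (W J \<phi>)"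
proof
  have zeroJ: "0 \<in> J p" for p using J[rule_format, of p] by auto
  show one: "1 \<in> algA J"
    using zeroJ by (simp add: algA_def flip: single_one) (simp add: zero_prod_def)
  show "a - b \<in> algA J" if "a \<in> algA J" "b \<in> algA J" for a b :: "('g, 'n, 'f) alg"
    using algA_diff[OF that] .
  show "a * b \<in> algA J" if "a \<in> algA J" "b \<in> algA J" for a b :: "('g, 'n, 'f) alg"
    using algA_mult[OF J that] .
  show "a = 0" if "of_nat k * a = 0" "k > 0" for a :: "('g, 'n, 'f) alg" and k
  proof (rule poly_mapping_eqI)
    fix x
    have "Poly_Mapping.lookup (scl (of_nat k) a) x = 0"
      using that by (simp flip: of_nat_mult_eq_scl)
    then show "Poly_Mapping.lookup a x = Poly_Mapping.lookup 0 x"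
      using that by (simp add: lookup_scl)
  qed
  show "D a \<in> algA J" if "D \<in> W J \<phi>" "a \<in> algA J" for D a
    using that by (auto simp: W_def W_op_def intro!: algA_sum algA_mult[OF J] algA_partial[OF J])
  show "D a = 0" if "D \<in> W J \<phi>" "a \<notin> algA J" for D a
    using that by (auto simp: W_def W_op_def)
  show "D (a + b) = D a + D b" if "D \<in> W J \<phi>" "a \<in> algA J" "b \<in> algA J" for D a b
    using that by (auto simp: W_def W_op_def algA_add partial_add sum.distrib algebra_simps)
  show "D (a * b) = D a * b + a * D b" if "D \<in> W J \<phi>" "a \<in> algA J" "b \<in> algA J" for D a b
    using that hom by (auto simp: W_def W_op_def algA_mult[OF J] partial_mult sum.distrib
        sum_distrib_left sum_distrib_right algebra_simps)
  show "smul a D \<in> W J \<phi>" if a: "a \<in> algA J" and D: "D \<in> W J \<phi>" for a D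
  proof -
    obtain u where u: "D = W_op J \<phi> u" "\<forall>p. u p \<in> algA J" using D by (auto simp: W_def)
    have "smul a D = W_op J \<phi> (\<lambda>p. a * u p)"
      by (auto simp: u smul_def W_op_def fun_eq_iff sum_distrib_left mult.assoc)
    then show ?thesis using u a algA_mult[OF J] by (auto simp: W_def)
  qed
  show "commutator D E \<in> W J \<phi>" if DE: "D \<in> W J \<phi>" "E \<in> W J \<phi>" for D E
  proof -
    obtain u v where uv: "D = W_op J \<phi> u" "\<forall>p. u p \<in> algA J" "E = W_op J \<phi> v" "\<forall>p. v p \<in> algA J"
      using DE by (auto simp: W_def)
    have "(\<Sum>p\<in>UNIV. u p * partial \<phi> p (v q) - partial \<phi> p (u q) * v p) \<in> algA J" for q
      using uv(2,4) by (intro algA_sum algA_diff algA_mult[OF J] algA_partial[OF J]) auto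
    then show ?thesis
      using commutator_W_op[OF J hom uv(2,4)] uv(1,3) by (auto simp: W_def)
  qed
  show "1 \<in> K"
    if "K \<subseteq> algA J" "\<And>a b. \<lbrakk>a \<in> K; b \<in> K\<rbrakk> \<Longrightarrow> a + b \<in> K"
      "\<And>a b. \<lbrakk>a \<in> algA J; b \<in> K\<rbrakk> \<Longrightarrow> a * b \<in> K"
      "\<And>D a. \<lbrakk>D \<in> W J \<phi>; a \<in> K\<rbrakk> \<Longrightarrow> D a \<in> K" "x \<in> K" "x \<noteq> 0" for K x
  proof (rule stable_ideal_contains_one[OF J hom separating that(2,3) _ that(5,6)])
    show "partial \<phi> p a \<in> K" if a: "a \<in> K" for p a
    proof -
      \<comment> \<open>The coordinate vector of \<open>\<partial>\<^sub>p\<close> itself.\<close>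
      let ?u = "\<lambda>q. if q = p then 1 else 0"
      have "W_op J \<phi> ?u \<in> W J \<phi>" using one by (auto simp: W_def)
      then have "W_op J \<phi> ?u a \<in> K" using \<open>\<And>D a. \<lbrakk>D \<in> W J \<phi>; a \<in> K\<rbrakk> \<Longrightarrow> D a \<in> K\<close> a by blast
      moreover have "a \<in> algA J" using a \<open>K \<subseteq> algA J\<close> by blast
      ultimately show ?thesis by (simp add: W_op_def if_distrib[of "\<lambda>x. x * _"] cong: if_cong)
    qed
  qed
qed

theorem theorem2p2:
  fixes J :: "'n::finite \<Rightarrow> nat set"
    and \<phi> :: "'n \<Rightarrow> 'g::ab_group_add \<Rightarrow> 'f::field_char_0"
  assumes J: "\<forall>p. J p \<in> {{0}, UNIV}"
    and torsion: "torsion_free TYPE('g)"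
    and hom: "\<forall>p. Modules.additive (\<phi> p)"
    and nondegenerate: "\<forall>p. J p = {0} \<longrightarrow> (\<Inter>q\<in>{q. q \<noteq> p}. ker (\<phi> q)) - ker (\<phi> p) \<noteq> {}"
    and separating: "(\<Inter>p. ker (\<phi> p)) = {0}"
  shows "simple_lie_algebra op_scl (W J \<phi>) commutator"
proof -
  interpret derivation_simple "algA J" "W J \<phi>"
    by (rule W_derivation_simple[OF J hom separating])
  interpret vs: vector_space "op_scl :: 'f \<Rightarrow> (('g, 'n, 'f) alg \<Rightarrow> ('g, 'n, 'f) alg) \<Rightarrow> _"
    by unfold_locales
      (auto simp: op_scl_def fun_eq_iff lookup_scl lookup_add algebra_simps intro!: poly_mapping_eqI)
  have op_scl_W: "op_scl c D \<in> W J \<phi>" if D: "D \<in> W J \<phi>" for c D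
  proof -
    obtain u where u: "D = W_op J \<phi> u" "\<forall>p. u p \<in> algA J" using D by (auto simp: W_def)
    have "op_scl c D = W_op J \<phi> (\<lambda>p. scl c (u p))"
      by (auto simp: u op_scl_def W_op_def fun_eq_iff scl_eq_mult sum_distrib_left mult.assoc)
    then show ?thesis using u by (auto simp: W_def scl_in_algA)
  qed
  have add_W: "D + E \<in> W J \<phi>" if DE: "D \<in> W J \<phi>" "E \<in> W J \<phi>" for D E
  proof -
    obtain u v where uv: "D = W_op J \<phi> u" "\<forall>p. u p \<in> algA J" "E = W_op J \<phi> v" "\<forall>p. v p \<in> algA J"
      using DE by (auto simp: W_def)
    have "D + E = W_op J \<phi> (\<lambda>p. u p + v p)"
      by (auto simp: uv W_op_def fun_eq_iff sum.distrib algebra_simps)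
    then show ?thesis using uv by (auto simp: W_def algA_add)
  qed
  have zero_W: "0 \<in> W J \<phi>"
    unfolding W_def by (rule CollectI, rule exI[of _ "\<lambda>_. 0"]) (auto simp: W_op_def fun_eq_iff)
  have scl_arg: "D (scl c a) = scl c (D a)" if "D \<in> W J \<phi>" "a \<in> algA J" for D c a
    using that by (auto simp: W_def W_op_scl_arg)
  have scale_right: "commutator D (op_scl c E) = op_scl c (commutator D E)"
    if DE: "D \<in> W J \<phi>" "E \<in> W J \<phi>" for D E c
  proof
    fix x
    have diff: "scl c (a - b) = scl c a - scl c b" for a b :: "('g, 'n, 'f) alg"
      by (rule poly_mapping_eqI) (simp add: lookup_scl lookup_minus algebra_simps)
    show "commutator D (op_scl c E) x = op_scl c (commutator D E) x"
      using DE L_outside[OF DE(1), of x] L_outside[OF DE(2), of x]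
      by (cases "x \<in> algA J") (auto simp: commutator_def op_scl_def diff scl_arg L_closed L_zero)
  qed
  interpret lie_algebra op_scl "W J \<phi>" commutator
  proof
    show "vs.subspace (W J \<phi>)"
      by (intro vs.subspaceI zero_W add_W op_scl_W)
    show "commutator (op_scl c D) E = op_scl c (commutator D E)"
      if "D \<in> W J \<phi>" "E \<in> W J \<phi>" for D E c
    proof -
      have "commutator (op_scl c D) E = - commutator E (op_scl c D)"
        by (simp add: commutator_def fun_eq_iff)
      also have "\<dots> = - op_scl c (commutator E D)"
        using scale_right[OF that(2,1)] by simp
      also have "\<dots> = op_scl c (- commutator E D)"
        by (rule vs.scale_minus_right[symmetric])
      also have "- commutator E D = commutator D E"
        by (simp add: commutator_def fun_eq_iff)
      finally show ?thesis .
    qed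
  qed (simp_all add: L_commutator commutator_add_left commutator_add_right commutator_jacobi
      scale_right, simp add: commutator_def fun_eq_iff)
  \<comment> \<open>Every \<open>\<partial>\<^sub>p\<close> is nonzero: it does not kill \<open>x\<^bsup>\<alpha>,0\<^esup>\<close> with \<open>\<phi>\<^sub>p(\<alpha>) \<noteq> 0\<close> if \<open>J p = {0}\<close>, and it
    sends \<open>x\<^bsup>0,1\<^sub>p\<^esup>\<close> to \<open>1\<close> otherwise.\<close>
  obtain D where "D \<in> W J \<phi>" "D \<noteq> 0"
  proof -
    fix p :: 'n
    define D where "D = W_op J \<phi> (\<lambda>q. if q = p then 1 else 0)"
    have D: "D \<in> W J \<phi>" using R_one by (auto simp: D_def W_def)
    have D_eq: "D a = partial \<phi> p a" if "a \<in> algA J" for a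
      using that by (simp add: D_def W_op_def if_distrib[of "\<lambda>x. x * _"] cong: if_cong)
    have zeroJ: "0 \<in> J q" for q using J[rule_format, of q] by auto
    have single_neq_0: "Poly_Mapping.single k c \<noteq> 0" if "c \<noteq> 0" for k :: "'g \<times> (nat ^ 'n)" and c :: 'f
      using that by (metis lookup_single_eq lookup_zero)
    have "\<exists>a\<in>algA J. partial \<phi> p a \<noteq> 0"
    proof (cases "J p = {0}")
      case True
      then obtain \<alpha> where \<alpha>: "\<phi> p \<alpha> \<noteq> 0" using nondegenerate by (fastforce simp: ker_def)
      let ?a = "xpow \<alpha> 0 :: ('g, 'n, 'f) alg"
      have "?a \<in> algA J"
        using zeroJ by (simp add: algA_def)
      moreover have "partial \<phi> p ?a = Poly_Mapping.single (\<alpha>, 0) (\<phi> p \<alpha>)"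
        by (simp add: partial_single)
      ultimately show ?thesis using single_neq_0[OF \<alpha>] by metis
    next
      case False
      then have "J p = UNIV" using J by blast
      let ?a = "xpow 0 (axis p 1) :: ('g, 'n, 'f) alg"
      have "?a \<in> algA J"
        using \<open>J p = UNIV\<close> zeroJ by (auto simp: algA_def axis_def)
      moreover have "partial \<phi> p ?a = Poly_Mapping.single (0, 0) 1"
        using additive.zero[OF hom[rule_format, of p]] by (simp add: partial_single)
      ultimately show ?thesis using single_neq_0[OF one_neq_zero] by metis
    qed
    then have "D \<noteq> 0" using D_eq by fastforce
    with D show thesis by (rule that)
  qed
  show ?thesis
  proof
    show "\<exists>D\<in>W J \<phi>. \<exists>E\<in>W J \<phi>. commutator D E \<noteq> 0"
      by (rule not_abelian) fact+
    show "I = {0} \<or> I = W J \<phi>" if I: "lie_ideal I" for I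
    proof (cases "I = {0}")
      case False
      have sub: "vs.subspace I" using I by (simp add: lie_ideal_def)
      then obtain D where "D \<in> I" "D \<noteq> 0" using False vs.subspace_0 by blast
      then show ?thesis
        using I vs.subspace_diff[OF sub] by (intro disjI2 ideal_trivial) (auto simp: lie_ideal_def)
    qed simp
  qed
qed

end
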